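(* Let $k\ge3$ and $n\ge n_0(k)$ be integers, let $1<p<2$ with conjugate exponent $p'$ ($1/p+1/p'=1$), and fix $B>0$ together with the associated constant $C=C(B)>0$. For large $\lambda\in\Gamma_{n,k}$ and $\lambda^{1/k}\le N\lesssim\lambda^{1/k}$, set $Q=(\log N)^C$ and let $M_\lambda$ be the convolution operator on $\mathbb Z^n$ with Fourier multiplier $$\widehat{M_\lambda}(\boldsymbol\xi)=\frac{\lambda^{n/k-1}}{P(\lambda)}\sum_{1\le\mathbf q\le Q}\ \sum_{\mathbf a\in\mathbb U_{\mathbf q}}\mathfrak S(\lambda;\mathbf a,\mathbf q)\,\psi_{N/Q}(\mathbf q\boldsymbol\xi-\mathbf a)\,\widetilde{d\sigma_\lambda}(\boldsymbol\xi-\mathbf a/\mathbf q),\qquad \boldsymbol\xi\in\mathbb T^n .$$ Then there is a constant $C_{p,n,k}$ (which may depend on the fixed $B$ and $C$, but not on $\lambda$ or $f$) such that for all large $\lambda\in\Gamma_{n,k}$ and all $f\in\ell^p(\mathbb Z^n)$, $$\|M_\lambda f\|_{\ell^{p'}(\mathbb Z^n)}\le C_{p,n,k}\,\lambda^{\left(\frac{2-n}{k}\right)\left(\frac2p-1\right)}(\log N)^{C\left(\frac2p-1\right)}\,\|f\|_{\ell^p(\mathbb Z^n)} .$$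
   Context: Notation: $e(t)=e^{2\pi i t}$; $\varphi$ is Euler's function; $[q,r]=\mathrm{lcm}[q,r]$; $\mathbb U_q=(\mathbb Z/q\mathbb Z)^*$. For $\mathbf q=(q_1,\dots,q_n)$ with all $q_i\ge1$: $\mathbb U_{\mathbf q}=\mathbb U_{q_1}\times\dots\times\mathbb U_{q_n}$, $\mathbf a/\mathbf q=(a_1/q_1,\dots,a_n/q_n)$, $\mathbf q\boldsymbol\xi=(q_1\xi_1,\dots,q_n\xi_n)$; the condition $1\le\mathbf q\le Q$ means $1\le q_i\le Q$ for all $i$. Since $\boldsymbol\xi\in\mathbb T^n=(\mathbb R/\mathbb Z)^n$, the multiplier is understood $1$-periodically in each coordinate (equivalently, for $\boldsymbol\xi\in\mathbb R^n$, the sum over $\mathbf a$ runs over all integer vectors with $\gcd(a_i,q_i)=1$ for all $i$). The threshold: $n_0(k)=2^k+1$ for $k=2,3,4$, and for $k\ge5$, $n_0(k)=k^2+3-\max_{1\le j\le k-1}\left\lceil\frac{kj-\min(2^j,j^2+j)}{k-j+1}\right\rceil$. $P(\lambda)=\sum(\log p_1)\cdots(\log p_n)$, the sum over all vectors $(p_1,\dots,p_n)$ of primes with $p_1^k+\dots+p_n^k=\lambda$. $\Gamma_{n,k}\subset\mathbb N$ is a fixed infinite arithmetic progression along which Hua's asymptotic $P(\lambda)\sim\mathfrak S_{n,k}(\lambda)\lambda^{n/k-1}$ holds as $\lambda\to\infty$, the singular series $\mathfrak S_{n,k}(\lambda)$ being bounded above and below by positive constants independent of $\lambda\in\Gamma_{n,k}$.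 Exponential sums and singular series: $$g(a,q;b,r)=\frac1{\varphi([q,r])}\sum_{x\in\mathbb U_{[q,r]}}e\Big(\frac{ax^k}{q}+\frac{bx}{r}\Big),\qquad \mathfrak S(\lambda;\mathbf a,\mathbf q)=\sum_{q=1}^\infty\sum_{a\in\mathbb U_q}e(-\lambda a/q)\prod_{i=1}^n g(a,q;a_i,q_i).$$ Cutoff: $\psi$ is a fixed smooth function on $\mathbb R^n$ with $\mathbf 1_{\mathcal Q}(\mathbf x)\le\psi(\mathbf x)\le\mathbf 1_{\mathcal Q}(\mathbf x/2)$, $\mathcal Q=[-1,1]^n$, and $\psi_t(\mathbf x)=\psi(t\mathbf x)$. $\widetilde{d\sigma_\lambda}$ is the Fourier transform on $\mathbb R^n$ of the continuous $k$-spherical surface measure $d\sigma_\lambda$, i.e. the measure on $\{\mathbf t\in\mathbb R^n: t_i>0,\ t_1^k+\dots+t_n^k=\lambda\}$ given by $\lambda^{1-n/k}\,\delta(t_1^k+\dots+t_n^k-\lambda)\,d\mathbf t$ (Gelfand--Leray measure, normalized so that its total mass does not depend on $\lambda$). Choice of $C(B)$: let $\sigma_\lambda(\mathbf x)=\frac1{P(\lambda)}(\log x_1)\cdots(\log x_n)$ if all $x_i$ are prime and $x_1^k+\dots+x_n^k=\lambda$, and $\sigma_\lambda(\mathbf x)=0$ otherwise. For each $B>0$, $C=C(B)>0$ is a constant (it exists by earlier work) such that, with $Q=(\log N)^C$, the error $\widehat{E_\lambda}=\widehat{\sigma_\lambda}-\widehat{M_\lambda}$ satisfies $\|\widehat{E_\lambda}\|_{L^\infty(\mathbb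 T^n)}\lesssim(\log\lambda)^{-B}$ for large $\lambda\in\Gamma_{n,k}$. *)

theory Defs
  imports
    "HOL-Analysis.Analysis"
    "HOL-Number_Theory.Number_Theory"
    "HOL-Library.Landau_Symbols"
begin

definition waring_threshold :: "nat \<Rightarrow> int" where
  "waring_threshold k =
     (if k \<le> 4 then 2 ^ k + 1
      else (int k)\<^sup>2 + 3 -
        (MAX j \<in> {1..k - 1}.
           \<lceil>(real k * real j - min (2 ^ j) ((real j)\<^sup>2 + real j)) / (real k - real j + 1)\<rceil>))"

definition unit_char :: "real \<Rightarrow> complex" where
  "unit_char t = exp (2 * of_real pi * \<i> * of_real t)"

abbreviation of_int_vec :: "int ^ 'n \<Rightarrow> real ^ 'n" where
  "of_int_vec x \<equiv> (\<chi> i. real_of_int (x $ i))"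


text \<open>The parameter of type \<open>'n itself\<close> carries the number of variables where it
  does not occur in the type of another argument.\<close>

definition prime_reps :: "nat \<Rightarrow> nat \<Rightarrow> (int ^ 'n) set" where
  "prime_reps k l = {x. (\<forall>i. prime (x $ i)) \<and> (\<Sum>i\<in>UNIV. (x $ i) ^ k) = int l}"

definition prime_rep_weight :: "'n::finite itself \<Rightarrow> nat \<Rightarrow> nat \<Rightarrow> real" where
  "prime_rep_weight _ k l = (\<Sum>x \<in> (prime_reps k l :: (int ^ 'n) set). \<Prod>i\<in>UNIV. ln (real_of_int (x $ i)))"

definition sigma :: "nat \<Rightarrow> nat \<Rightarrow> int ^ 'n::finite \<Rightarrow> real" where
  "sigma k l x =
     (if x \<in> prime_reps k l
      then (\<Prod>i\<in>UNIV. ln (real_of_int (x $ i))) / prime_rep_weight TYPE('n) k l else 0)"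


text \<open>Residues modulo \<open>m\<close> prime to \<open>m\<close> are represented by \<^const>\<open>totatives\<close>.\<close>

definition gauss_sum :: "nat \<Rightarrow> int \<Rightarrow> nat \<Rightarrow> int \<Rightarrow> nat \<Rightarrow> complex" where
  "gauss_sum k a q b r =
     (\<Sum>x \<in> totatives (lcm q r). unit_char (real_of_int a * real x ^ k / real q + real_of_int b * real x / real r))
       / of_nat (totient (lcm q r))"

definition singular_series :: "nat \<Rightarrow> nat \<Rightarrow> int ^ 'n::finite \<Rightarrow> nat ^ 'n \<Rightarrow> complex" where
  "singular_series k l av qv =
     (\<Sum>m. let q = Suc m in
        \<Sum>a \<in> totatives q. unit_char (- (real l * real a / real q)) *
          (\<Prod>i\<in>UNIV. gauss_sum k (int a) q (av $ i) (qv $ i)))"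

text \<open>The singular series in Hua's asymptotic formula is the product of all local densities.
  Those at the finite places multiply to the series at \<open>a = (0, \<dots>, 0)\<close>,
  \<open>q = (1, \<dots>, 1)\<close>, which is real; the density at the infinite place is the Gamma factor.\<close>

definition hua_singular_series :: "'n::finite itself \<Rightarrow> nat \<Rightarrow> nat \<Rightarrow> real" where
  "hua_singular_series _ k l =
     Gamma (1 + 1 / real k) ^ CARD('n) / Gamma (real CARD('n) / real k) *
     Re (singular_series k l (0 :: int ^ 'n) 1)"

definition arithmetic_progression :: "nat set \<Rightarrow> bool" where
  "arithmetic_progression G \<longleftrightarrow> (\<exists>a d. d > 0 \<and> G = range (\<lambda>j. a + d * j))"

definition hua_progression :: "'n::finite itself \<Rightarrow> nat \<Rightarrow> nat set \<Rightarrow> bool" where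
  "hua_progression T k G \<longleftrightarrow>
     arithmetic_progression G \<and>
     prime_rep_weight T k \<sim>[inf at_top (principal G)]
       (\<lambda>l. hua_singular_series T k l * real l powr (real CARD('n) / real k - 1)) \<and>
     (\<exists>c1 c2. 0 < c1 \<and>
        (\<forall>l\<in>G. c1 \<le> hua_singular_series T k l \<and> hua_singular_series T k l \<le> c2))"


fun continuously_differentiable ::
    "nat \<Rightarrow> ('a::euclidean_space \<Rightarrow> 'b::real_normed_vector) \<Rightarrow> bool" where
  "continuously_differentiable 0 f \<longleftrightarrow> continuous_on UNIV f"
| "continuously_differentiable (Suc m) f \<longleftrightarrow>
     (\<forall>x. f differentiable (at x)) \<and>
     (\<forall>v. continuously_differentiable m (\<lambda>x. frechet_derivative f (at x) v))"

definition smooth :: "('a::euclidean_space \<Rightarrow> 'b::real_normed_vector) \<Rightarrow> bool" where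
  "smooth f \<longleftrightarrow> (\<forall>m. continuously_differentiable m f)"

definition cutoff :: "(real ^ 'n \<Rightarrow> real) \<Rightarrow> bool" where
  "cutoff \<psi> \<longleftrightarrow> smooth \<psi> \<and>
     (\<forall>x. indicator (cbox (- 1) 1) x \<le> \<psi> x \<and> \<psi> x \<le> indicator (cbox (- 1) 1) (x /\<^sub>R 2))"


text \<open>The Gelfand--Leray measure \<open>\<delta>(F(t) - s) dt\<close> is given by its integrals: since
  \<open>\<delta>\<close> is the derivative of the Heaviside function, the integral of \<open>\<phi>\<close> is the
  derivative with respect to \<open>s\<close> of the integral of \<open>\<phi>\<close> over \<open>F(t) \<le> s\<close>.
  Here \<open>F(t) = t\<^sub>1\<^sup>k + \<dots> + t\<^sub>n\<^sup>k\<close> on the open positive orthant.\<close>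

definition gelfand_leray_integral :: "nat \<Rightarrow> real \<Rightarrow> (real ^ 'n \<Rightarrow> complex) \<Rightarrow> complex" where
  "gelfand_leray_integral k s \<phi> =
     vector_derivative
       (\<lambda>u. LINT t:{t. (\<forall>i. 0 < t $ i) \<and> (\<Sum>i\<in>UNIV. (t $ i) ^ k) \<le> u}|lborel. \<phi> t) (at s)"

text \<open>All Fourier transforms have the kernel \<open>unit_char (x \<bullet> \<xi>)\<close> with positive sign. This is the sign
  for which the arithmetic factor at \<open>\<xi> = b/r\<close> is \<open>gauss_sum k a q b r\<close> and not
  \<open>gauss_sum k a q (-b) r\<close>.\<close>

definition surface_fourier :: "nat \<Rightarrow> nat \<Rightarrow> real ^ 'n \<Rightarrow> complex" where
  "surface_fourier k l \<xi> =
     of_real (real l powr (1 - real CARD('n) / real k)) *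
     gelfand_leray_integral k (real l) (\<lambda>t. unit_char (t \<bullet> \<xi>))"

definition fourier :: "(int ^ 'n \<Rightarrow> complex) \<Rightarrow> real ^ 'n \<Rightarrow> complex" where
  "fourier f \<xi> = (\<Sum>\<^sub>\<infinity>x. f x * unit_char (of_int_vec x \<bullet> \<xi>))"

text \<open>The torus is represented by the unit cube.\<close>

definition multiplier_kernel :: "(real ^ 'n \<Rightarrow> complex) \<Rightarrow> int ^ 'n \<Rightarrow> complex" where
  "multiplier_kernel m x = (LINT \<xi>:cbox 0 1|lborel. m \<xi> * unit_char (- (of_int_vec x \<bullet> \<xi>)))"

definition multiplier_operator ::
    "(real ^ 'n \<Rightarrow> complex) \<Rightarrow> (int ^ 'n \<Rightarrow> complex) \<Rightarrow> int ^ 'n \<Rightarrow> complex" where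
  "multiplier_operator m f x = (\<Sum>\<^sub>\<infinity>y. multiplier_kernel m (x - y) * f y)"

text \<open>The sum over \<open>a\<close> extends over all integer vectors with \<open>gcd(a\<^sub>i, q\<^sub>i) = 1\<close>, which makes
  the multiplier periodic; if \<open>N, Q > 0\<close> and \<open>\<psi>\<close> is a cutoff, it has finitely many
  nonzero terms.\<close>

definition M_hat ::
    "nat \<Rightarrow> (real ^ 'n \<Rightarrow> real) \<Rightarrow> nat \<Rightarrow> real \<Rightarrow> real \<Rightarrow> real ^ 'n \<Rightarrow> complex" where
  "M_hat k \<psi> l N Q \<xi> =
     of_real (real l powr (real CARD('n) / real k - 1) / prime_rep_weight TYPE('n) k l) *
     (\<Sum>q \<in> {q :: nat ^ 'n. \<forall>i. 1 \<le> q $ i \<and> real (q $ i) \<le> Q}.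
        \<Sum>\<^sub>\<infinity>a \<in> {a :: int ^ 'n. \<forall>i. coprime (a $ i) (int (q $ i))}.
          singular_series k l a q *
          of_real (\<psi> ((N / Q) *\<^sub>R (\<chi> i. real (q $ i) * \<xi> $ i - real_of_int (a $ i)))) *
          surface_fourier k l (\<chi> i. \<xi> $ i - real_of_int (a $ i) / real (q $ i)))"

text \<open>\<open>C\<close> is admissible for \<open>B\<close>: with \<open>Q = (log N)\<^sup>C\<close>, the \<open>L\<^sup>\<infinity>\<close> norm of the
  transform of the error is \<open>O((log \<lambda>)\<^sup>-\<^sup>B)\<close> along \<open>G\<close>. The number \<open>K\<close> is the
  implied constant in \<open>N \<lesssim> \<lambda>\<^sup>1\<^sup>/\<^sup>k\<close>.\<close>

definition admissible_exponent ::
    "nat \<Rightarrow> (real ^ 'n \<Rightarrow> real) \<Rightarrow> nat set \<Rightarrow> real \<Rightarrow> real \<Rightarrow> real \<Rightarrow> bool" where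
  "admissible_exponent k \<psi> G K B C \<longleftrightarrow>
     (\<exists>A. \<forall>\<^sub>F l in inf at_top (principal G).
        \<forall>N. real l powr (1 / real k) \<le> N \<and> N \<le> K * real l powr (1 / real k) \<longrightarrow>
          (AE \<xi> in lborel. \<xi> \<in> cbox 0 1 \<longrightarrow>
             norm (fourier (\<lambda>x. of_real (sigma k l x)) \<xi> - M_hat k \<psi> l N (ln N powr C) \<xi>)
               \<le> A * ln (real l) powr (- B)))"

definition lp_space :: "real \<Rightarrow> ('a \<Rightarrow> complex) set" where
  "lp_space p = {f. (\<lambda>x. norm (f x) powr p) summable_on UNIV}"

definition lp_norm :: "real \<Rightarrow> ('a \<Rightarrow> complex) \<Rightarrow> real" where
  "lp_norm p f = (\<Sum>\<^sub>\<infinity>x. norm (f x) powr p) powr (1 / p)"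

end

theory Submission
  imports Defs "HOL-Real_Asymp.Real_Asymp"
begin

text \<open>Interpolate between \<open>\<ell>\<^sup>2 \<rightarrow> \<ell>\<^sup>2\<close> and \<open>\<ell>\<^sup>1 \<rightarrow> \<ell>\<^sup>\<infinity>\<close>. Since \<open>\<sigma>\<^sub>\<lambda>\<close> is a probability measure and the error
  transform is bounded, the multiplier of \<open>M\<^sub>\<lambda>\<close> is essentially bounded; this is the \<open>\<ell>\<^sup>2\<close> bound.
  The multiplier is supported in boxes of side \<open>4 Q / N\<close> around the points \<open>a / q\<close>, so the same
  essential bound gives \<open>\<bar>K(x)\<bar> \<lesssim> (Q\<^sup>3 / N)\<^sup>n\<close> for the kernel, which is smaller
  than \<open>\<lambda>\<^sup>(\<^sup>2\<^sup>-\<^sup>n\<^sup>)\<^sup>/\<^sup>k Q\<close> because \<open>Q\<close> is a power of \<open>log N\<close>. No estimate of the singular series or of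
  the surface measure is needed.\<close>

subsection \<open>Interpolation for kernels\<close>

text \<open>The terms are dominated by a geometric series of ratio \<open>2 powr (- r)\<close>
  running down from the largest power of two not exceeding \<open>t\<close>. Levels may be negative,
  and the bound is uniform in \<open>J\<close>.\<close>

lemma sum_powr_dyadic_le:
  fixes J :: "int set" and r t :: real
  assumes "finite J" and r: "r > 0" and t: "t \<ge> 0"
  shows "(\<Sum>j | j \<in> J \<and> 2 powr j \<le> t. (2 powr j) powr r) \<le> t powr r / (1 - 2 powr (- r))"
proof (cases "t = 0")
  case True
  then have "{j \<in> J. 2 powr real_of_int j \<le> t} = {}"
    by (auto simp: not_le)
  then show ?thesis using True by simp
next
  case False
  then have t: "t > 0" using t by simp
  define m where "m = \<lfloor>log 2 t\<rfloor>"
  define s :: real where "s = 2 powr (- r)"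
  define J' where "J' = {j \<in> J. 2 powr real_of_int j \<le> t}"
  have s: "0 < s" "s < 1"
    using r by (auto simp: s_def powr_less_one)
  have jm: "j \<le> m" if "j \<in> J'" for j
  proof -
    have "real_of_int j \<le> log 2 t"
      using that t by (simp add: J'_def le_log_iff)
    then show ?thesis unfolding m_def by (simp add: le_floor_iff)
  qed
  have mt: "2 powr m \<le> t"
    using t by (simp add: m_def flip: le_log_iff)
  have eq: "(2 powr j) powr r = (2 powr m) powr r * s ^ nat (m - j)" if "j \<in> J'" for j
    using jm[OF that]
    by (simp add: s_def powr_powr powr_add[symmetric] algebra_simps flip: powr_realpow)
  have "(\<Sum>j\<in>J'. (2 powr j) powr r) = (2 powr m) powr r * (\<Sum>j\<in>J'. s ^ nat (m - j))"
    unfolding sum_distrib_left by (rule sum.cong) (use eq in auto)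
  also have "(\<Sum>j\<in>J'. s ^ nat (m - j)) = (\<Sum>i\<in>(\<lambda>j. nat (m - j)) ` J'. s ^ i)"
    by (subst sum.reindex) (auto simp: inj_on_def dest!: jm)
  also have "\<dots> \<le> (\<Sum>i. s ^ i)"
    by (rule sum_le_suminf) (use s \<open>finite J\<close> in \<open>auto simp: J'_def summable_geometric\<close>)
  also have "\<dots> = 1 / (1 - s)"
    using s by (simp add: suminf_geometric)
  finally have "(\<Sum>j\<in>J'. (2 powr j) powr r) \<le> (2 powr m) powr r * (1 / (1 - s))"
    by simp
  also have "\<dots> \<le> t powr r * (1 / (1 - s))"
    by (intro mult_right_mono powr_mono2) (use mt r s in auto)
  finally show ?thesis by (simp add: J'_def s_def)
qed

text \<open>Tested only on finite sums, so that the bound makes sense before any convergence of the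
  full rows is known.\<close>

definition l2_bounded :: "real \<Rightarrow> ('a \<Rightarrow> 'b \<Rightarrow> complex) \<Rightarrow> bool" where
  "l2_bounded A \<kappa> \<longleftrightarrow> (\<forall>F X f. finite F \<longrightarrow> finite X \<longrightarrow>
     (\<Sum>x\<in>X. (norm (\<Sum>y\<in>F. \<kappa> x y * f y))\<^sup>2) \<le> A\<^sup>2 * (\<Sum>y\<in>F. (norm (f y))\<^sup>2))"

text \<open>The factor 4 is the square of the 2 lost in passing to the small part of the function,
  \<open>2 powr r\<close> is the loss in rounding to a dyadic level, and the denominator comes from
  the geometric series over the levels.\<close>

definition interpolation_const :: "real \<Rightarrow> real \<Rightarrow> real" where
  "interpolation_const A r = 4 * A\<^sup>2 * 2 powr r / (1 - 2 powr (- r))"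

lemma interpolation_const_nonneg: "r > 0 \<Longrightarrow> interpolation_const A r \<ge> 0"
  unfolding interpolation_const_def by (simp add: powr_less_one less_imp_le)

text \<open>Marcinkiewicz interpolation: at the dyadic level \<open>2\<^sup>j\<close> of \<open>T f\<close> the function \<open>f\<close> is cut
  at the height for which the \<open>\<ell>\<^sup>1 \<rightarrow> \<ell>\<^sup>\<infinity>\<close> bound makes the large part contribute at most
  \<open>2\<^sup>j / 2\<close>; the small part is controlled in \<open>\<ell>\<^sup>2\<close>.\<close>

lemma kernel_interpolation_finite:
  fixes \<kappa> :: "'a \<Rightarrow> 'b \<Rightarrow> complex"
  assumes p: "1 < p" "p < 2" and pp': "1 / p + 1 / p' = 1"
    and \<delta>: "\<delta> > 0" "\<And>x y. norm (\<kappa> x y) \<le> \<delta>"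
    and l2: "l2_bounded A \<kappa>" and F: "finite F" and X: "finite X"
  shows "(\<Sum>x\<in>X. norm (\<Sum>y\<in>F. \<kappa> x y * f y) powr p') \<le>
    interpolation_const A (p' - 2) * (2 * \<delta>) powr (p' - 2) *
      (\<Sum>y\<in>F. norm (f y) powr p) powr (p' - 1)"
proof -
  define r where "r = p' - 2"
  have p': "p' = p / (p - 1)"
  proof -
    have "p' \<noteq> 0" using pp' p by auto
    then show ?thesis using pp' p by (simp add: field_simps)
  qed
  have r: "r > 0" using p by (simp add: r_def p' field_simps)
  have p'r: "p' = r + 2" by (simp add: r_def)
  \<comment> \<open>This identity makes \<open>(norm (f y))\<^sup>2 * \<tau> y powr r\<close> a
    multiple of \<open>norm (f y) powr p\<close>, so that the last sum over \<open>y\<close>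
    collapses to \<open>S\<close>.\<close>
  have pr: "(1 - p) * r + 2 = p"
    using p by (simp add: r_def p' field_simps)
  define T where "T g x = (\<Sum>y\<in>F. \<kappa> x y * g y)" for g x
  define S where "S = (\<Sum>y\<in>F. norm (f y) powr p)"
  have S0: "S \<ge> 0" unfolding S_def by (intro sum_nonneg) auto
  show ?thesis
  proof (cases "S = 0")
    case True
    then have "norm (f y) powr p = 0" if "y \<in> F" for y
      using that F unfolding S_def by (subst (asm) sum_nonneg_eq_0_iff) auto
    then have "(\<Sum>y\<in>F. \<kappa> x y * f y) = 0" for x
      by (intro sum.neutral) auto
    then show ?thesis
      using interpolation_const_nonneg[OF r] by (simp add: r_def)
  next
    case False
    then have S: "S > 0" using S0 by simp
    \<comment> \<open>As \<open>1 - p\<close> is negative, \<open>2 powr i \<le> \<tau> y\<close>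
      says that \<open>f y\<close> is small relative to the level \<open>i\<close>. The constant is
      chosen so that every removed value satisfies \<open>\<delta> * norm (f y) \<le> norm (f y)
      powr p * 2 powr i / (2 * S)\<close>, which sums to at most \<open>2 powr i / 2\<close>. At a
      zero of \<open>f\<close> the default value of \<open>powr\<close> gives
      \<open>\<tau> y = 0\<close>, and \<open>g i y\<close> is 0 in either case.\<close>
    define \<tau> where "\<tau> y = 2 * \<delta> * S * norm (f y) powr (1 - p)" for y
    define j where "j x = \<lfloor>log 2 (norm (T f x))\<rfloor>" for x
    define g where "g i y = (if 2 powr real_of_int i \<le> \<tau> y then f y else 0)" for i y
    have jle: "2 powr j x \<le> norm (T f x)" "norm (T f x) \<le> 2 * 2 powr j x"
      if "T f x \<noteq> 0" for x
    proof -
      have "log 2 (norm (T f x)) \<le> j x + 1"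
        unfolding j_def by linarith
      then have "norm (T f x) \<le> 2 powr (j x + 1)"
        using that by (subst (asm) log_le_iff) auto
      then show "norm (T f x) \<le> 2 * 2 powr j x" by (simp add: powr_add)
      show "2 powr j x \<le> norm (T f x)"
        using that by (simp add: j_def flip: le_log_iff)
    qed
    \<comment> \<open>Cutting off the large values changes \<open>T f x\<close> by at most half of
      \<open>2 powr j x\<close>, hence by at most half of its own modulus. The small part retains
      the other half.\<close>
    have half: "norm (T f x) \<le> 2 * norm (T (g (j x)) x)" if x: "T f x \<noteq> 0" for x
    proof -
      have "norm (T f x - T (g (j x)) x) = norm (\<Sum>y\<in>F. \<kappa> x y * (f y - g (j x) y))"
        by (simp add: T_def sum_subtractf right_diff_distrib)
      also have "\<dots> \<le> (\<Sum>y\<in>F. norm (f y) powr p * 2 powr j x / (2 * S))"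
      proof (rule sum_norm_le)
        fix y assume "y \<in> F"
        show "norm (\<kappa> x y * (f y - g (j x) y)) \<le> norm (f y) powr p * 2 powr j x / (2 * S)"
        proof (cases "2 powr real_of_int (j x) \<le> \<tau> y \<or> f y = 0")
          case True
          then show ?thesis using S by (auto simp: g_def)
        next
          case False
          then have lt: "\<tau> y < 2 powr j x" and fy: "f y \<noteq> 0" by auto
          have "norm (\<kappa> x y * (f y - g (j x) y)) \<le> \<delta> * norm (f y)"
            using False \<delta>(2)[of x y] by (simp add: g_def norm_mult mult_right_mono)
          also have "norm (f y) = norm (f y) powr p * norm (f y) powr (1 - p)"
            using fy by (simp flip: powr_add)
          also have "\<delta> * \<dots> = norm (f y) powr p * \<tau> y / (2 * S)"
            using S by (simp add: \<tau>_def)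
          also have "\<dots> \<le> norm (f y) powr p * 2 powr j x / (2 * S)"
            using lt S by (intro divide_right_mono mult_left_mono) auto
          finally show ?thesis .
        qed
      qed
      also have "\<dots> = 2 powr j x / 2"
        using S by (simp add: S_def flip: sum_distrib_right sum_divide_distrib)
      also have "\<dots> \<le> norm (T f x) / 2"
        using jle[OF x] by simp
      finally have "norm (T f x - T (g (j x)) x) \<le> norm (T f x) / 2" .
      then show ?thesis
        using norm_triangle_ineq[of "T f x - T (g (j x)) x" "T (g (j x)) x"] by simp
    qed
    \<comment> \<open>The exponent splits as \<open>r + 2\<close>: the power \<open>r\<close> is
      estimated by the level, the square by the small part.\<close>
    have pointwise: "norm (T f x) powr p' \<le>
        (2 * 2 powr j x) powr r * (4 * (norm (T (g (j x)) x))\<^sup>2)" for x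
    proof (cases "T f x = 0")
      case False
      have "norm (T f x) powr p' = norm (T f x) powr r * (norm (T f x))\<^sup>2"
        using False by (simp add: p'r powr_add)
      also have "\<dots> \<le> (2 * 2 powr j x) powr r * (2 * norm (T (g (j x)) x))\<^sup>2"
        using jle[OF False] half[OF False] r
        by (intro mult_mono powr_mono2 power_mono) auto
      finally show ?thesis by (simp add: power_mult_distrib)
    qed auto
    define J where "J = j ` X"
    have J: "finite J" using X by (simp add: J_def)
    have "(\<Sum>x\<in>X. norm (T f x) powr p')
        \<le> (\<Sum>x\<in>X. (2 * 2 powr j x) powr r * (4 * (norm (T (g (j x)) x))\<^sup>2))"
      by (intro sum_mono pointwise)
    \<comment> \<open>The truncation \<open>g (j x)\<close> varies with \<open>x\<close>. Adding all
      occurring levels replaces it by functions \<open>g i\<close> independent of \<open>x\<close>,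
      to which the \<open>\<ell>\<^sup>2\<close> bound applies.\<close>
    also have "\<dots> \<le> (\<Sum>x\<in>X. \<Sum>i\<in>J. (2 * 2 powr i) powr r * (4 * (norm (T (g i) x))\<^sup>2))"
    proof (intro sum_mono)
      fix x assume "x \<in> X"
      then show "(2 * 2 powr j x) powr r * (4 * (norm (T (g (j x)) x))\<^sup>2)
          \<le> (\<Sum>i\<in>J. (2 * 2 powr i) powr r * (4 * (norm (T (g i) x))\<^sup>2))"
        using J by (intro member_le_sum) (auto simp: J_def)
    qed
    also have "\<dots> = (\<Sum>i\<in>J. (2 * 2 powr i) powr r * 4 * (\<Sum>x\<in>X. (norm (T (g i) x))\<^sup>2))"
      by (subst sum.swap) (simp add: sum_distrib_left mult.assoc)
    also have "\<dots> \<le> (\<Sum>i\<in>J. (2 * 2 powr i) powr r * 4 * (A\<^sup>2 * (\<Sum>y\<in>F. (norm (g i y))\<^sup>2)))"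
      using l2 F X unfolding l2_bounded_def T_def
      by (intro sum_mono mult_left_mono) auto
    also have "\<dots> = 4 * A\<^sup>2 * 2 powr r *
        (\<Sum>i\<in>J. \<Sum>y\<in>F. (2 powr i) powr r * (norm (g i y))\<^sup>2)"
      by (simp add: sum_distrib_left powr_mult mult_ac)
    \<comment> \<open>For fixed \<open>y\<close> only the levels up to \<open>\<tau> y\<close>
      retain \<open>f y\<close>, which leaves a sum of the form treated in
      \<open>sum_powr_dyadic_le\<close>.\<close>
    also have "(\<Sum>i\<in>J. \<Sum>y\<in>F. (2 powr i) powr r * (norm (g i y))\<^sup>2) =
        (\<Sum>y\<in>F. (norm (f y))\<^sup>2 * (\<Sum>i | i \<in> J \<and> 2 powr real_of_int i \<le> \<tau> y. (2 powr i) powr r))"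
      using J by (subst sum.swap)
        (auto simp: sum_distrib_left g_def sum.inter_filter intro!: sum.cong)
    also have "\<dots> \<le> (\<Sum>y\<in>F. (norm (f y))\<^sup>2 * (\<tau> y powr r / (1 - 2 powr (- r))))"
      using J r \<delta> S by (intro sum_mono mult_left_mono sum_powr_dyadic_le) (auto simp: \<tau>_def)
    also have "\<dots> = (2 * \<delta> * S) powr r / (1 - 2 powr (- r)) * S"
    proof -
      have "(norm (f y))\<^sup>2 * \<tau> y powr r = (2 * \<delta> * S) powr r * norm (f y) powr p" for y
      proof (cases "f y = 0")
        case False
        have "(norm (f y))\<^sup>2 * \<tau> y powr r =
            (2 * \<delta> * S) powr r * (norm (f y) powr ((1 - p) * r) * norm (f y) powr 2)"
          using False \<delta> S by (simp add: \<tau>_def powr_mult powr_powr)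
        also have "norm (f y) powr ((1 - p) * r) * norm (f y) powr 2 = norm (f y) powr p"
          unfolding powr_add[symmetric] pr ..
        finally show ?thesis .
      qed (use p in auto)
      then have eq: "(norm (f y))\<^sup>2 * (\<tau> y powr r / (1 - 2 powr (- r))) =
          (2 * \<delta> * S) powr r / (1 - 2 powr (- r)) * norm (f y) powr p" for y
        by (simp add: field_simps)
      show ?thesis
        unfolding eq by (simp only: S_def flip: sum_distrib_left)
    qed
    also have "4 * A\<^sup>2 * 2 powr r * ((2 * \<delta> * S) powr r / (1 - 2 powr (- r)) * S) =
        interpolation_const A r * (2 * \<delta>) powr r * S powr (r + 1)"
      using S \<delta> by (simp add: interpolation_const_def powr_mult powr_add)
    finally have "(\<Sum>x\<in>X. norm (T f x) powr p') \<le>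
        interpolation_const A r * (2 * \<delta>) powr r * S powr (r + 1)"
      by (simp add: mult_left_mono)
    then show ?thesis
      unfolding T_def S_def r_def by (simp add: algebra_simps)
  qed
qed

section \<open>From finite sums to all of \<open>lp_space p\<close>\<close>

text \<open>Testing the bound at the single output point \<open>x\<close> with the conjugate row as
  input gives \<open>s\<^sup>2 \<le> A\<^sup>2 * s\<close> for each partial sum \<open>s\<close>,
  hence \<open>s \<le> A\<^sup>2\<close>.\<close>

lemma l2_bounded_row_summable:
  assumes "l2_bounded A \<kappa>"
  shows "(\<lambda>y. (norm (\<kappa> x y))\<^sup>2) summable_on UNIV"
proof (rule nonneg_bdd_above_summable_on)
  have "(\<Sum>y\<in>F. (norm (\<kappa> x y))\<^sup>2) \<le> A\<^sup>2" if "finite F" for F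
  proof -
    define s where "s = (\<Sum>y\<in>F. (norm (\<kappa> x y))\<^sup>2)"
    have s: "s \<ge> 0" unfolding s_def by (intro sum_nonneg) auto
    have "(\<Sum>y\<in>F. \<kappa> x y * cnj (\<kappa> x y)) = of_real s"
      by (simp only: s_def of_real_sum complex_norm_square)
    moreover have "(norm (\<Sum>y\<in>F. \<kappa> x y * cnj (\<kappa> x y)))\<^sup>2 \<le> A\<^sup>2 * s"
      using assms[unfolded l2_bounded_def, rule_format, OF that, of "{x}" "\<lambda>y. cnj (\<kappa> x y)"]
      by (simp add: s_def)
    ultimately have "s\<^sup>2 \<le> A\<^sup>2 * s"
      using s by simp
    then show ?thesis
      using s unfolding s_def[symmetric] by (cases "s = 0") (auto simp: power2_eq_square)
  qed
  then show "bdd_above (sum (\<lambda>y. (norm (\<kappa> x y))\<^sup>2) ` {F. F \<subseteq> UNIV \<and> finite F})"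
    by (intro bdd_aboveI2[where M = "A\<^sup>2"]) auto
qed auto

text \<open>Each \<open>norm (f y) powr p\<close> is at most the total sum, so the surplus power
  \<open>2 - p\<close> of \<open>norm (f y)\<close> is bounded and comparison with the
  \<open>p\<close>-th powers applies.\<close>

lemma lp_space_square_summable:
  assumes f: "f \<in> lp_space p" and p: "0 < p" "p < 2"
  shows "(\<lambda>y. (norm (f y))\<^sup>2) summable_on UNIV"
proof -
  have sf: "(\<lambda>y. norm (f y) powr p) summable_on UNIV"
    using f by (simp add: lp_space_def)
  define S where "S = (\<Sum>\<^sub>\<infinity>y. norm (f y) powr p)"
  have le: "norm (f y) powr p \<le> S" for y
    using finite_sum_le_infsum[OF sf, of "{y}"] by (simp add: S_def)
  have "(norm (f y))\<^sup>2 \<le> norm (f y) powr p * S powr ((2 - p) / p)" for y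
  proof (cases "f y = 0")
    case False
    have "(norm (f y))\<^sup>2 = norm (f y) powr p * (norm (f y) powr p) powr ((2 - p) / p)"
      using False p by (simp add: powr_powr flip: powr_add)
    also have "\<dots> \<le> norm (f y) powr p * S powr ((2 - p) / p)"
      using le[of y] p by (intro mult_left_mono powr_mono2) auto
    finally show ?thesis .
  qed auto
  then show ?thesis
    by (intro summable_on_comparison_test[OF summable_on_cmult_left[OF sf]]) auto
qed

text \<open>The rows converge by Cauchy-Schwarz, since both the row and \<open>f\<close> are square
  summable. The finite inequality then passes to the limit, first in the input set and then in the
  output set.\<close>

lemma kernel_interpolation:
  fixes \<kappa> :: "'a \<Rightarrow> 'b \<Rightarrow> complex"
  assumes p: "1 < p" "p < 2" and pp': "1 / p + 1 / p' = 1"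
    and \<delta>: "\<delta> > 0" "\<And>x y. norm (\<kappa> x y) \<le> \<delta>"
    and l2: "l2_bounded A \<kappa>" and f: "f \<in> lp_space p"
  shows "(\<lambda>y. \<kappa> x y * f y) summable_on UNIV"
    and "(\<lambda>x. \<Sum>\<^sub>\<infinity>y. \<kappa> x y * f y) \<in> lp_space p'"
    and "lp_norm p' (\<lambda>x. \<Sum>\<^sub>\<infinity>y. \<kappa> x y * f y) \<le>
      interpolation_const A (p' - 2) powr (1 / p') * (2 * \<delta>) powr (2 / p - 1) * lp_norm p f"
proof -
  have p'0: "p' \<noteq> 0" using pp' p by auto
  have p': "p' = p / (p - 1)"
    using p'0 pp' p by (simp add: field_simps)
  have p'2: "p' > 2" using p by (simp add: p' field_simps)
  have sf: "(\<lambda>y. norm (f y) powr p) summable_on UNIV"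
    using f by (simp add: lp_space_def)
  define S where "S = (\<Sum>\<^sub>\<infinity>y. norm (f y) powr p)"
  define Tf where "Tf x = (\<Sum>\<^sub>\<infinity>y. \<kappa> x y * f y)" for x
  define D where "D = interpolation_const A (p' - 2) * (2 * \<delta>) powr (p' - 2) * S powr (p' - 1)"
  have c0: "interpolation_const A (p' - 2) \<ge> 0"
    using p'2 by (intro interpolation_const_nonneg) auto
  have S0: "S \<ge> 0" unfolding S_def by (intro infsum_nonneg) auto
  show summ: "(\<lambda>y. \<kappa> x y * f y) summable_on UNIV" for x
    by (rule abs_summable_summable, rule abs_summable_product)
      (use l2_bounded_row_summable[OF l2] lp_space_square_summable[OF f] p
        in \<open>auto simp: norm_power simp flip: power2_eq_square\<close>)
  \<comment> \<open>The output set \<open>X\<close> stays fixed while \<open>F\<close> grows, so the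
    left side is a finite sum of continuous functions of convergent row sums; all finite bounds lie
    below \<open>D\<close>.\<close>
  have fin: "(\<Sum>x\<in>X. norm (Tf x) powr p') \<le> D" if X: "finite X" for X
  proof (rule tendsto_upperbound)
    show "((\<lambda>F. \<Sum>x\<in>X. norm (\<Sum>y\<in>F. \<kappa> x y * f y) powr p') \<longlongrightarrow>
        (\<Sum>x\<in>X. norm (Tf x) powr p')) (finite_subsets_at_top UNIV)"
      unfolding Tf_def using p'2
      by (intro tendsto_sum tendsto_powr' tendsto_norm infsum_tendsto summ tendsto_const) auto
    show "\<forall>\<^sub>F F in finite_subsets_at_top UNIV.
        (\<Sum>x\<in>X. norm (\<Sum>y\<in>F. \<kappa> x y * f y) powr p') \<le> D"
    proof (rule eventually_finite_subsets_at_top_weakI)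
      fix F :: "'b set" assume F: "finite F"
      have "(\<Sum>x\<in>X. norm (\<Sum>y\<in>F. \<kappa> x y * f y) powr p') \<le>
          interpolation_const A (p' - 2) * (2 * \<delta>) powr (p' - 2) *
            (\<Sum>y\<in>F. norm (f y) powr p) powr (p' - 1)"
        by (rule kernel_interpolation_finite[OF p pp' \<delta> l2 F X])
      also have "\<dots> \<le> D"
        unfolding D_def S_def using F sf p'2 c0
        by (intro mult_left_mono powr_mono2 finite_sum_le_infsum sum_nonneg mult_nonneg_nonneg) auto
      finally show "(\<Sum>x\<in>X. norm (\<Sum>y\<in>F. \<kappa> x y * f y) powr p') \<le> D" .
    qed
  qed auto
  have sT: "(\<lambda>x. norm (Tf x) powr p') summable_on UNIV"
    by (rule nonneg_bdd_above_summable_on) (auto intro!: bdd_aboveI2 fin)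
  then show "(\<lambda>x. \<Sum>\<^sub>\<infinity>y. \<kappa> x y * f y) \<in> lp_space p'"
    by (simp add: lp_space_def Tf_def)
  \<comment> \<open>Under the root of order \<open>p'\<close> the exponent of
    \<open>2 * \<delta>\<close> becomes \<open>2 / p - 1\<close> and that of \<open>S\<close>
    becomes \<open>1 / p\<close>, so that the norm of \<open>f\<close> appears.\<close>
  have "lp_norm p' Tf \<le> D powr (1 / p')"
    unfolding lp_norm_def using p'2
    by (intro powr_mono2 infsum_nonneg infsum_le_finite_sums[OF sT] fin) auto
  also have "\<dots> = interpolation_const A (p' - 2) powr (1 / p') * (2 * \<delta>) powr ((p' - 2) / p') *
      S powr ((p' - 1) / p')"
    using c0 \<delta> S0 by (simp add: D_def powr_mult powr_powr)
  also have "(p' - 2) / p' = 2 / p - 1"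
    using p by (simp add: p' field_simps)
  also have "(p' - 1) / p' = 1 / p"
    using p by (simp add: p' field_simps)
  finally show "lp_norm p' (\<lambda>x. \<Sum>\<^sub>\<infinity>y. \<kappa> x y * f y) \<le>
      interpolation_const A (p' - 2) powr (1 / p') * (2 * \<delta>) powr (2 / p - 1) * lp_norm p f"
    by (simp add: Tf_def[abs_def] S_def lp_norm_def)
qed

subsection \<open>Multipliers on the torus\<close>

text \<open>The torus with its Haar measure, up to the null set where opposite faces are identified.
  As a finite measure it makes bounded measurable functions integrable.\<close>

definition unit_cube :: "(real ^ 'n) measure" where
  "unit_cube = restrict_space lborel (cbox 0 1)"

definition character :: "int ^ 'n \<Rightarrow> real ^ 'n \<Rightarrow> complex" where
  "character x \<xi> = unit_char (of_int_vec x \<bullet> \<xi>)"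

lemma finite_measure_unit_cube: "finite_measure (unit_cube :: (real ^ 'n) measure)"
  unfolding unit_cube_def
  using emeasure_bounded_finite[OF bounded_cbox, of "0 :: real ^ 'n" 1]
  by (intro finite_measureI) (auto simp: space_restrict_space emeasure_restrict_space)

lemma norm_unit_char [simp]: "norm (unit_char t) = 1"
  by (simp add: unit_char_def)

lemma unit_char_add: "unit_char (s + t) = unit_char s * unit_char t"
  by (simp add: unit_char_def algebra_simps exp_add)

lemma cnj_unit_char: "cnj (unit_char t) = unit_char (- t)"
  by (simp add: unit_char_def exp_cnj)

lemma continuous_unit_char [continuous_intros]:
  "continuous_on S f \<Longrightarrow> continuous_on S (\<lambda>x. unit_char (f x))"
  unfolding unit_char_def by (intro continuous_intros)

lemma unit_char_of_int: "unit_char (real_of_int m) = 1"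
proof -
  have "unit_char (real_of_int m) = exp ((2 * of_int m * of_real pi) * \<i>)"
    unfolding unit_char_def by (rule arg_cong[of _ _ exp]) simp
  also have "\<dots> = 1" using exp_integer_2pi[of "real_of_int m"] by simp
  finally show ?thesis .
qed

lemma norm_character [simp]: "norm (character x \<xi>) = 1"
  by (simp add: character_def)

lemma cnj_character: "cnj (character x \<xi>) = character (- x) \<xi>"
proof -
  have "(of_int_vec (- x) :: real ^ 'a) = - of_int_vec x" by (simp add: vec_eq_iff)
  then show ?thesis by (simp add: character_def cnj_unit_char)
qed

lemma character_add: "character (x + y) \<xi> = character x \<xi> * character y \<xi>"
proof -
  have "(of_int_vec (x + y) :: real ^ 'a) = of_int_vec x + of_int_vec y" by (simp add: vec_eq_iff)
  then show ?thesis by (simp add: character_def unit_char_add inner_add_left)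
qed

lemma character_measurable [measurable]: "character x \<in> borel_measurable unit_cube"
  unfolding unit_cube_def character_def
  by (intro measurable_restrict_space1 borel_measurable_continuous_onI continuous_intros)
    (simp add: borel_measurable_continuous_onI continuous_intros)

lemma cnj_character_measurable [measurable]:
  "(\<lambda>\<xi>. cnj (character x \<xi>)) \<in> borel_measurable unit_cube"
  unfolding cnj_character by measurable

section \<open>Orthogonality of characters, Parseval and Bessel\<close>

lemma integral_unit_char:
  "has_bochner_integral lborel (\<lambda>t. indicator {0..1} t *\<^sub>R unit_char (real_of_int m * t))
     (if m = 0 then 1 else 0)"
proof -
  define F where "F t = (if m = 0 then of_real t else
     unit_char (real_of_int m * t) / (2 * of_real pi * \<i> * of_int m))" for t :: real
  have "(F has_vector_derivative unit_char (real_of_int m * t)) (at t within {0..1})" for t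
  proof (cases "m = 0")
    case True
    then show ?thesis
      by (auto simp: F_def[abs_def] unit_char_def intro!: derivative_eq_intros)
  next
    case False
    have "((\<lambda>z. exp (2 * of_real pi * \<i> * (of_int m * z)) / (2 * of_real pi * \<i> * of_int m))
        has_field_derivative exp (2 * of_real pi * \<i> * (of_int m * of_real t)))
        (at (of_real t))"
      using False by (auto intro!: derivative_eq_intros)
    from has_vector_derivative_real_field[OF this]
    have "((\<lambda>t. exp (2 * of_real pi * \<i> * (of_int m * of_real t)) / (2 * of_real pi * \<i> * of_int m))
        has_vector_derivative exp (2 * of_real pi * \<i> * (of_int m * of_real t))) (at t within {0..1})" .
    then show ?thesis using False
      by (simp add: F_def[abs_def] unit_char_def)
  qed
  then have "has_bochner_integral lborel
      (\<lambda>t. indicator {0..1} t *\<^sub>R unit_char (real_of_int m * t)) (F 1 - F 0)"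
    by (intro has_bochner_integral_FTC_Icc continuous_intros) auto
  \<comment> \<open>For nonzero \<open>m\<close> the antiderivative has period 1, so its values at
    the two ends agree.\<close>
  moreover have "F 1 - F 0 = (if m = 0 then 1 else 0)"
    using unit_char_of_int[of m] unit_char_of_int[of 0] by (simp add: F_def)
  ultimately show ?thesis by simp
qed

text \<open>The character and the indicator of the cube factor over the coordinates. Fubini leaves a
  product of one-dimensional integrals, and a nonzero coordinate of \<open>x\<close> makes one of
  them vanish.\<close>

lemma integral_character:
  "(\<integral>\<xi>. character (x :: int ^ 'n) \<xi> \<partial>unit_cube) = (if x = 0 then 1 else 0)"
proof -
  \<comment> \<open>The factors are indexed by \<open>Basis\<close>, because
    \<open>lborel_eq\<close> presents Lebesgue measure as an image of the product measure over
    \<open>Basis\<close>; \<open>of_int_vec x \<bullet> b\<close> is the coordinate of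
    \<open>x\<close> that belongs to \<open>b\<close>.\<close>
  define h where "h b t = indicator {0..1} t *\<^sub>R unit_char ((of_int_vec x \<bullet> b) * t)"
    for b :: "real ^ 'n" and t :: real
  have [measurable]: "h b \<in> borel_measurable borel" for b
    unfolding h_def by (intro borel_measurable_scaleR borel_measurable_indicator
      borel_measurable_continuous_onI continuous_intros) auto
  have h: "has_bochner_integral lborel (h b)
      (if of_int_vec x \<bullet> b = 0 then 1 else 0)" if "b \<in> Basis" for b
  proof -
    obtain i where "b = axis i 1" using \<open>b \<in> Basis\<close> by (auto simp: Basis_vec_def)
    then show ?thesis
      using integral_unit_char[of "x $ i"]
      by (simp add: h_def[abs_def] inner_axis)
  qed
  have ind: "indicator (cbox 0 1) \<xi> = (\<Prod>b\<in>Basis. indicator {0..1} (\<xi> \<bullet> b) :: real)"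
    for \<xi> :: "real ^ 'n"
  proof (cases "\<xi> \<in> cbox 0 1")
    case True
    then have "\<xi> \<bullet> b \<in> {0..1}" if "b \<in> Basis" for b
      using that by (auto simp: mem_box_cart Basis_vec_def inner_axis)
    then show ?thesis using True by simp
  next
    case False
    then obtain i where "\<xi> $ i \<notin> {0..1}" by (auto simp: mem_box_cart)
    moreover have "axis i 1 \<in> (Basis :: (real ^ 'n) set)" by (auto simp: Basis_vec_def)
    ultimately have "(\<Prod>b\<in>Basis. indicator {0..1} (\<xi> \<bullet> b) :: real) = 0"
      by (intro prod_zero) (auto intro!: bexI[of _ "axis i 1"] simp: inner_axis)
    then show ?thesis using False by simp
  qed
  have char: "character x \<xi> = (\<Prod>b\<in>Basis. unit_char ((of_int_vec x \<bullet> b) * (\<xi> \<bullet> b)))" for \<xi>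
    unfolding character_def unit_char_def
    by (subst euclidean_inner) (simp add: sum_distrib_left exp_sum)
  have "(\<integral>\<xi>. character x \<xi> \<partial>unit_cube) =
      (\<integral>\<xi>. (\<Prod>b\<in>Basis. h b (\<xi> \<bullet> b)) \<partial>lborel)"
    unfolding unit_cube_def
    by (subst integral_restrict_space)
      (auto simp: ind char h_def scaleR_conv_of_real prod.distrib of_real_prod)
  also have "\<dots> = (\<integral>f. (\<Prod>b\<in>Basis. h b ((\<Sum>b'\<in>Basis. f b' *\<^sub>R b') \<bullet> b))
      \<partial>(\<Pi>\<^sub>M b\<in>(Basis :: (real ^ 'n) set). lborel))"
    by (subst lborel_eq[where 'a = "real ^ 'n"], rule integral_distr) measurable
  also have "\<dots> = (\<integral>f. (\<Prod>b\<in>Basis. h b (f b)) \<partial>(\<Pi>\<^sub>M b\<in>(Basis :: (real ^ 'n) set). lborel))"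
    by (intro Bochner_Integration.integral_cong prod.cong refl)
      (simp add: inner_sum_left inner_Basis if_distrib sum.delta cong: if_cong)
  also have "\<dots> = (\<Prod>b\<in>(Basis :: (real ^ 'n) set). \<integral>t. h b t \<partial>lborel)"
  proof -
    interpret product_sigma_finite "\<lambda>_ :: real ^ 'n. lborel :: real measure" ..
    show ?thesis
      using h by (intro product_integral_prod) (auto simp: has_bochner_integral_iff)
  qed
  also have "\<dots> = (\<Prod>b\<in>Basis. if of_int_vec x \<bullet> b = 0 then 1 else 0)"
    using h by (intro prod.cong refl) (simp add: has_bochner_integral_iff)
  also have "\<dots> = (if x = 0 then 1 else 0)"
  proof (cases "x = 0")
    case False
    then obtain i where "x $ i \<noteq> 0" by (auto simp: vec_eq_iff)
    moreover have "axis i 1 \<in> (Basis :: (real ^ 'n) set)" by (auto simp: Basis_vec_def)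
    ultimately have "\<exists>b\<in>Basis. (of_int_vec x :: real ^ 'n) \<bullet> b \<noteq> 0"
      by (intro bexI[of _ "axis i 1"]) (auto simp: inner_axis)
    then have "(\<Prod>b\<in>Basis. if (of_int_vec x :: real ^ 'n) \<bullet> b = 0 then 1 else 0 :: complex) = 0"
      by (intro prod_zero) auto
    then show ?thesis using False by simp
  qed (auto simp: inner_vec_def)
  finally show ?thesis .
qed

lemma integral_character_mult_cnj:
  "(\<integral>\<xi>. character x \<xi> * cnj (character y \<xi>) \<partial>unit_cube) = (if x = y then 1 else 0)"
  using integral_character[of "x - y"]
  by (simp add: cnj_character flip: character_add)

text \<open>Parseval for trigonometric polynomials: after expansion of the square, orthogonality
  leaves the diagonal.\<close>

lemma integral_norm_square_character_sum:
  assumes F: "finite F"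
  shows "(\<integral>\<xi>. (norm (\<Sum>y\<in>F. f y * character y \<xi>))\<^sup>2 \<partial>unit_cube) = (\<Sum>y\<in>F. (norm (f y))\<^sup>2)"
proof -
  interpret finite_measure unit_cube by (rule finite_measure_unit_cube)
  have int: "integrable unit_cube (\<lambda>\<xi>. f y * cnj (f z) * (character y \<xi> * cnj (character z \<xi>)))" for y z
    by (rule integrable_const_bound[where B = "norm (f y * cnj (f z))"]) (auto simp: norm_mult)
  have "of_real (\<integral>\<xi>. (norm (\<Sum>y\<in>F. f y * character y \<xi>))\<^sup>2 \<partial>unit_cube) =
      (\<integral>\<xi>. (\<Sum>y\<in>F. \<Sum>z\<in>F. f y * cnj (f z) * (character y \<xi> * cnj (character z \<xi>))) \<partial>unit_cube)"
    unfolding integral_complex_of_real[symmetric] complex_norm_square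
    by (simp add: cnj_sum sum_product mult_ac)
  also have "\<dots> = (\<Sum>y\<in>F. \<Sum>z\<in>F. f y * cnj (f z) * (if y = z then 1 else 0))"
    using int by (simp add: integral_character_mult_cnj)
  also have "\<dots> = of_real (\<Sum>y\<in>F. (norm (f y))\<^sup>2)"
    unfolding of_real_sum complex_norm_square
    using F by (simp add: if_distrib sum.delta cong: if_cong)
  finally show ?thesis by (simp only: of_real_eq_iff)
qed

text \<open>With \<open>g\<close> the partial Fourier sum of \<open>h\<close> over \<open>X\<close>,
  expand the nonnegative integral of \<open>(norm (h \<xi> - g \<xi>))\<^sup>2\<close>. The integral
  of \<open>Re (h \<xi> * cnj (g \<xi>))\<close> and that of \<open>(norm (g \<xi>))\<^sup>2\<close>
  both equal the sum on the left. The essential bound supplies integrability.\<close>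

lemma bessel_inequality_unit_cube:
  fixes h :: "real ^ 'n \<Rightarrow> complex"
  assumes X: "finite X" and h [measurable]: "h \<in> borel_measurable unit_cube"
    and bd: "AE \<xi> in unit_cube. norm (h \<xi>) \<le> R"
  shows "(\<Sum>x\<in>X. (norm (\<integral>\<xi>. h \<xi> * cnj (character x \<xi>) \<partial>unit_cube))\<^sup>2) \<le>
    (\<integral>\<xi>. (norm (h \<xi>))\<^sup>2 \<partial>unit_cube)"
proof -
  interpret finite_measure "unit_cube :: (real ^ 'n) measure" by (rule finite_measure_unit_cube)
  define c where "c x = (\<integral>\<xi>. h \<xi> * cnj (character x \<xi>) \<partial>unit_cube)" for x
  define g where "g \<xi> = (\<Sum>x\<in>X. c x * character x \<xi>)" for \<xi>
  have [measurable]: "g \<in> borel_measurable unit_cube" unfolding g_def by measurable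
  have gb: "norm (g \<xi>) \<le> (\<Sum>x\<in>X. norm (c x))" for \<xi>
    unfolding g_def by (rule sum_norm_le) (simp add: norm_mult)
  have ih: "integrable unit_cube (\<lambda>\<xi>. h \<xi> * cnj (character x \<xi>))" for x
    using bd by (intro integrable_const_bound[where B = R]) (auto simp: norm_mult)
  have ih2: "integrable unit_cube (\<lambda>\<xi>. (norm (h \<xi>))\<^sup>2)"
    by (rule integrable_const_bound[where B = "R\<^sup>2"], use bd in eventually_elim)
      (auto intro: power_mono)
  have ig2: "integrable unit_cube (\<lambda>\<xi>. (norm (g \<xi>))\<^sup>2)"
    by (rule integrable_const_bound[where B = "(\<Sum>x\<in>X. norm (c x))\<^sup>2"])
      (auto intro!: always_eventually power_mono gb)
  have hg: "h \<xi> * cnj (g \<xi>) = (\<Sum>x\<in>X. cnj (c x) * (h \<xi> * cnj (character x \<xi>)))" for \<xi>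
    by (simp add: g_def sum_distrib_left mult_ac)
  have ihg: "integrable unit_cube (\<lambda>\<xi>. h \<xi> * cnj (g \<xi>))"
    unfolding hg using ih by auto
  have "(\<integral>\<xi>. h \<xi> * cnj (g \<xi>) \<partial>unit_cube) = (\<Sum>x\<in>X. cnj (c x) * c x)"
    unfolding hg using ih by (simp add: c_def)
  also have "\<dots> = of_real (\<Sum>x\<in>X. (norm (c x))\<^sup>2)"
    unfolding of_real_sum complex_norm_square by (simp add: mult.commute)
  finally have cross: "(\<integral>\<xi>. Re (h \<xi> * cnj (g \<xi>)) \<partial>unit_cube) = (\<Sum>x\<in>X. (norm (c x))\<^sup>2)"
    using ihg by (simp only: integral_Re) simp
  have "0 \<le> (\<integral>\<xi>. (norm (h \<xi> - g \<xi>))\<^sup>2 \<partial>unit_cube)"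
    by (rule Bochner_Integration.integral_nonneg) simp
  also have "(\<lambda>\<xi>. (norm (h \<xi> - g \<xi>))\<^sup>2) =
      (\<lambda>\<xi>. (norm (h \<xi>))\<^sup>2 - 2 * Re (h \<xi> * cnj (g \<xi>)) + (norm (g \<xi>))\<^sup>2)"
    by (rule ext) (simp only: cmod_power2, simp add: power2_eq_square algebra_simps)
  also have "(\<integral>\<xi>. (norm (h \<xi>))\<^sup>2 - 2 * Re (h \<xi> * cnj (g \<xi>)) + (norm (g \<xi>))\<^sup>2 \<partial>unit_cube) =
      (\<integral>\<xi>. (norm (h \<xi>))\<^sup>2 \<partial>unit_cube) - 2 * (\<Sum>x\<in>X. (norm (c x))\<^sup>2) + (\<Sum>x\<in>X. (norm (c x))\<^sup>2)"
    using ih2 ig2 ihg integral_norm_square_character_sum[OF X, of c]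
    by (simp add: cross[symmetric] integrable_Re g_def del: times_complex.sel)
  finally show ?thesis by (simp add: c_def)
qed

section \<open>Kernels of essentially bounded multipliers\<close>

lemma multiplier_kernel_unit_cube:
  "multiplier_kernel m x = (\<integral>\<xi>. m \<xi> * cnj (character x \<xi>) \<partial>unit_cube)"
  unfolding multiplier_kernel_def unit_cube_def set_lebesgue_integral_def character_def cnj_unit_char
  by (subst integral_restrict_space) auto

text \<open>The value \<open>0\<close> of a non-existent integral makes a proof that the multiplier is measurable
  unnecessary.\<close>

lemma multiplier_kernel_not_measurable:
  assumes "m \<notin> borel_measurable unit_cube"
  shows "multiplier_kernel m x = 0"
  unfolding multiplier_kernel_unit_cube
proof (rule not_integrable_integral_eq)
  have "m \<in> borel_measurable unit_cube"
    if "integrable unit_cube (\<lambda>\<xi>. m \<xi> * cnj (character x \<xi>))"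
  proof -
    from that have [measurable]: "(\<lambda>\<xi>. m \<xi> * cnj (character x \<xi>)) \<in> borel_measurable unit_cube"
      by auto
    \<comment> \<open>The character is unimodular, so multiplying by it undoes its conjugate and
      recovers \<open>m\<close>.\<close>
    have "(\<lambda>\<xi>. m \<xi> * cnj (character x \<xi>) * character x \<xi>) \<in> borel_measurable unit_cube"
      by measurable
    moreover have "m \<xi> * cnj (character x \<xi>) * character x \<xi> = m \<xi>" for \<xi>
      using complex_norm_square[of "character x \<xi>"] by (simp add: mult_ac)
    ultimately show ?thesis by simp
  qed
  then show "\<not> integrable unit_cube (\<lambda>\<xi>. m \<xi> * cnj (character x \<xi>))"
    using assms by blast
qed

text \<open>Applied to a finitely supported \<open>f\<close>, the kernel yields the Fourier
  coefficients of \<open>m\<close> times the trigonometric polynomial \<open>P\<close> of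
  \<open>f\<close>. Bessel, the bound on \<open>m\<close> and Parseval for \<open>P\<close> give the
  estimate. For a non-measurable \<open>m\<close> the kernel is zero.\<close>

lemma l2_bounded_multiplier_kernel:
  fixes m :: "real ^ 'n \<Rightarrow> complex"
  assumes bd: "AE \<xi> in unit_cube. norm (m \<xi>) \<le> R"
  shows "l2_bounded R (\<lambda>x y. multiplier_kernel m (x - y))"
proof (cases "m \<in> borel_measurable unit_cube")
  case False
  then show ?thesis
    by (simp add: l2_bounded_def multiplier_kernel_not_measurable sum_nonneg)
next
  case [measurable]: True
  interpret finite_measure "unit_cube :: (real ^ 'n) measure" by (rule finite_measure_unit_cube)
  show ?thesis
    unfolding l2_bounded_def
  proof (intro allI impI)
    fix F X :: "(int ^ 'n) set" and f :: "int ^ 'n \<Rightarrow> complex"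
    assume F: "finite F" and X: "finite X"
    define P where "P \<xi> = (\<Sum>y\<in>F. f y * character y \<xi>)" for \<xi>
    have [measurable]: "P \<in> borel_measurable unit_cube" unfolding P_def by measurable
    define L where "L = (\<Sum>y\<in>F. norm (f y))"
    have L: "norm (P \<xi>) \<le> L" for \<xi>
      unfolding P_def L_def by (rule sum_norm_le) (simp add: norm_mult)
    have im: "integrable unit_cube (\<lambda>\<xi>. m \<xi> * cnj (character (x - y) \<xi>))" for x y
      using bd by (intro integrable_const_bound[where B = R]) (auto simp: norm_mult)
    have "(\<Sum>y\<in>F. multiplier_kernel m (x - y) * f y) =
        (\<integral>\<xi>. (m \<xi> * P \<xi>) * cnj (character x \<xi>) \<partial>unit_cube)" for x
    proof -
      have "cnj (character (x - y) \<xi>) = cnj (character x \<xi>) * character y \<xi>" for y \<xi>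
        using character_add[of "- x" y \<xi>] by (simp add: cnj_character)
      then have "(m \<xi> * P \<xi>) * cnj (character x \<xi>) =
          (\<Sum>y\<in>F. m \<xi> * cnj (character (x - y) \<xi>) * f y)" for \<xi>
        by (simp add: P_def sum_distrib_left sum_distrib_right mult_ac)
      then show ?thesis
        using im by (simp add: multiplier_kernel_unit_cube)
    qed
    then have "(\<Sum>x\<in>X. (norm (\<Sum>y\<in>F. multiplier_kernel m (x - y) * f y))\<^sup>2) =
        (\<Sum>x\<in>X. (norm (\<integral>\<xi>. (m \<xi> * P \<xi>) * cnj (character x \<xi>) \<partial>unit_cube))\<^sup>2)"
      by simp
    also have "\<dots> \<le> (\<integral>\<xi>. (norm (m \<xi> * P \<xi>))\<^sup>2 \<partial>unit_cube)"
    proof (rule bessel_inequality_unit_cube[OF X])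
      show "AE \<xi> in unit_cube. norm (m \<xi> * P \<xi>) \<le> R * L"
        using bd by eventually_elim (use L in \<open>auto simp: norm_mult intro: mult_mono' \<close>)
    qed simp
    also have "\<dots> \<le> (\<integral>\<xi>. R\<^sup>2 * (norm (P \<xi>))\<^sup>2 \<partial>unit_cube)"
    proof (rule integral_mono_AE')
      show "integrable unit_cube (\<lambda>\<xi>. R\<^sup>2 * (norm (P \<xi>))\<^sup>2)"
        by (intro integrable_mult_right integrable_const_bound[where B = "L\<^sup>2"])
          (auto intro!: always_eventually power_mono L)
      show "AE \<xi> in unit_cube. (norm (m \<xi> * P \<xi>))\<^sup>2 \<le> R\<^sup>2 * (norm (P \<xi>))\<^sup>2"
        using bd by eventually_elim
          (auto simp: norm_mult power_mult_distrib intro!: mult_right_mono power_mono)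
    qed auto
    also have "\<dots> = R\<^sup>2 * (\<Sum>y\<in>F. (norm (f y))\<^sup>2)"
      using integral_norm_square_character_sum[OF F, of f] by (simp add: P_def)
    finally show "(\<Sum>x\<in>X. (norm (\<Sum>y\<in>F. multiplier_kernel m (x - y) * f y))\<^sup>2) \<le>
        R\<^sup>2 * (\<Sum>y\<in>F. (norm (f y))\<^sup>2)" .
  qed
qed

text \<open>The trivial bound by the integral of \<open>norm (m \<xi>)\<close>: essential supremum
  times the measure of a set containing the support within the cube.\<close>

lemma norm_multiplier_kernel_le:
  fixes m :: "real ^ 'n \<Rightarrow> complex"
  assumes bd: "AE \<xi> in unit_cube. norm (m \<xi>) \<le> R" and R: "R \<ge> 0"
    and E: "E \<in> sets borel" "emeasure lborel E < \<infinity>"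
    and supp: "\<And>\<xi>. \<xi> \<in> cbox 0 1 \<Longrightarrow> m \<xi> \<noteq> 0 \<Longrightarrow> \<xi> \<in> E"
  shows "norm (multiplier_kernel m x) \<le> R * measure lborel E"
proof -
  have "AE \<xi> in lborel. \<xi> \<in> cbox 0 1 \<longrightarrow> norm (m \<xi>) \<le> R"
    using bd unfolding unit_cube_def by (subst (asm) AE_restrict_space_iff) auto
  then have AE: "AE \<xi> in lborel. norm (indicator (cbox 0 1) \<xi> *\<^sub>R (m \<xi> * unit_char (- (of_int_vec x \<bullet> \<xi>))))
      \<le> R * indicator E \<xi>"
    by eventually_elim (use R supp in \<open>auto simp: norm_mult indicator_def\<close>)
  have "norm (multiplier_kernel m x) \<le>
      (\<integral>\<xi>. norm (indicator (cbox 0 1) \<xi> *\<^sub>R (m \<xi> * unit_char (- (of_int_vec x \<bullet> \<xi>)))) \<partial>lborel)"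
    unfolding multiplier_kernel_def set_lebesgue_integral_def by (rule integral_norm_bound)
  \<comment> \<open>Integrability is asked of the majorant only; a left side that is not integrable
    has integral 0.\<close>
  also have "\<dots> \<le> (\<integral>\<xi>. R * indicator E \<xi> \<partial>lborel)"
    using AE E R by (intro integral_mono_AE') auto
  also have "\<dots> = R * measure lborel E"
    using E by simp
  finally show ?thesis .
qed

subsection \<open>The multiplier of the major arcs\<close>

text \<open>The weights \<open>sigma k l x\<close> are nonnegative with total mass 1, or all zero in
  the degenerate case.\<close>

lemma norm_fourier_sigma_le:
  fixes \<xi> :: "real ^ 'n"
  shows "norm (fourier (\<lambda>x. of_real (sigma k l x)) \<xi>) \<le> 1"
proof -
  define W where "W = prime_rep_weight TYPE('n) k l"
  define w where "w x = (\<Prod>i\<in>UNIV. ln (real_of_int (x $ i)))" for x :: "int ^ 'n"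
  have W: "W = (\<Sum>x\<in>prime_reps k l. w x)"
    by (simp add: W_def w_def prime_rep_weight_def)
  have w: "w x \<ge> 0" if "x \<in> prime_reps k l" for x
    using that unfolding w_def
    by (intro prod_nonneg) (auto simp: prime_reps_def less_imp_le prime_gt_1_int intro!: ln_ge_zero)
  have \<sigma>: "sigma k l x = (if x \<in> prime_reps k l then w x / W else 0)" for x
    by (simp add: sigma_def w_def W_def)
  show ?thesis
  proof (cases "W = 0")
    case True
    \<comment> \<open>Division by zero gives 0 here.\<close>
    then have "sigma k l x = 0" for x :: "int ^ 'n" by (simp add: \<sigma>)
    then show ?thesis by (simp add: fourier_def)
  next
    case False
    \<comment> \<open>A sum over an infinite set is 0 by convention, so a nonzero \<open>W\<close>
      forces the set of representations to be finite.\<close>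
    then have fin: "finite (prime_reps k l :: (int ^ 'n) set)"
      using W sum.infinite by fastforce
    have W0: "W > 0" using False W w sum_nonneg[of "prime_reps k l" w] by fastforce
    have "fourier (\<lambda>x. of_real (sigma k l x)) \<xi> =
        (\<Sum>\<^sub>\<infinity>x\<in>prime_reps k l. of_real (w x / W) * unit_char (of_int_vec x \<bullet> \<xi>))"
      unfolding fourier_def by (rule infsum_cong_neutral) (auto simp: \<sigma>)
    also have "\<dots> = (\<Sum>x\<in>prime_reps k l. of_real (w x / W) * unit_char (of_int_vec x \<bullet> \<xi>))"
      using fin by simp
    also have "norm \<dots> \<le> (\<Sum>x\<in>prime_reps k l. w x / W)"
      using w W0 by (intro sum_norm_le) (simp add: norm_mult norm_divide)
    also have "\<dots> = 1"
      using False by (simp add: W flip: sum_divide_distrib)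
    finally show ?thesis .
  qed
qed

section \<open>Support of the multiplier and size of its kernel\<close>

text \<open>The lower indicator keeps \<open>\<psi>\<close> nonnegative, and the upper one vanishes
  outside the cube of half side 2, so \<open>\<psi>\<close> is squeezed to 0 there.\<close>

lemma cutoff_support:
  fixes \<psi> :: "real ^ 'n \<Rightarrow> real"
  assumes "cutoff \<psi>" "\<psi> y \<noteq> 0"
  shows "\<bar>y $ i\<bar> \<le> 2"
proof -
  have "indicator (cbox (- 1) 1) y \<le> \<psi> y" "\<psi> y \<le> indicator (cbox (- 1) 1) (y /\<^sub>R 2)"
    using assms(1) by (auto simp: cutoff_def)
  moreover have "0 \<le> \<psi> y"
    using calculation(1) by (rule order_trans[OF indicator_pos_le])
  ultimately have "y /\<^sub>R 2 \<in> cbox (- 1) 1"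
    using assms(2) by (cases "y /\<^sub>R 2 \<in> cbox (- 1) 1") auto
  then have "(- 1 :: real ^ 'n) $ i \<le> (y /\<^sub>R 2) $ i" "(y /\<^sub>R 2) $ i \<le> (1 :: real ^ 'n) $ i"
    unfolding mem_box_cart by blast+
  then show ?thesis by simp
qed

text \<open>Every term carries a factor \<open>\<psi>\<close>. If these factors all vanish at
  \<open>\<xi>\<close>, so does the multiplier; a nonzero one locates \<open>\<xi>\<close> near a
  fraction \<open>a / q\<close>.\<close>

lemma M_hat_support:
  fixes \<xi> :: "real ^ 'n"
  assumes \<psi>: "cutoff \<psi>" and NQ: "N > 0" "Q > 0" and nz: "M_hat k \<psi> l N Q \<xi> \<noteq> 0"
  obtains q :: "nat ^ 'n" and a :: "int ^ 'n"
  where "\<And>i. 1 \<le> q $ i" "\<And>i. real (q $ i) \<le> Q"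
    "\<And>i. \<bar>real (q $ i) * \<xi> $ i - real_of_int (a $ i)\<bar> \<le> 2 * Q / N"
proof -
  have "\<exists>q a. (\<forall>i. 1 \<le> q $ i \<and> real (q $ i) \<le> Q) \<and>
    \<psi> ((N / Q) *\<^sub>R (\<chi> i. real (q $ i) * \<xi> $ i - real_of_int (a $ i))) \<noteq> 0"
    (is ?ex)
  proof (rule ccontr)
    assume "\<not> ?ex"
    then have "\<psi> ((N / Q) *\<^sub>R (\<chi> i. real (q $ i) * \<xi> $ i - real_of_int (a $ i))) = 0"
      if "\<forall>i. 1 \<le> q $ i \<and> real (q $ i) \<le> Q" for q :: "nat ^ 'n" and a
      using that by blast
    then have "M_hat k \<psi> l N Q \<xi> = 0"
      unfolding M_hat_def by (subst sum.neutral) (auto intro!: infsum_0)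
    with nz show False by simp
  qed
  then obtain q a where q: "\<forall>i. 1 \<le> q $ i \<and> real (q $ i) \<le> Q" and
    a: "\<psi> ((N / Q) *\<^sub>R (\<chi> i. real (q $ i) * \<xi> $ i - real_of_int (a $ i))) \<noteq> 0"
    by blast
  have "\<bar>real (q $ i) * \<xi> $ i - real_of_int (a $ i)\<bar> \<le> 2 * Q / N" for i
  proof -
    have "N / Q * \<bar>real (q $ i) * \<xi> $ i - real_of_int (a $ i)\<bar> \<le> 2"
      using cutoff_support[OF \<psi> a, of i] NQ
      by (simp only: vector_scaleR_component vec_lambda_beta real_scaleR_def abs_mult) simp
    then show ?thesis using NQ by (simp add: field_simps)
  qed
  with q show ?thesis by (intro that[of q a]) auto
qed

lemma finite_card_vec_Collect:
  fixes S :: "'a set"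
  assumes "finite S"
  shows "finite {v :: 'a ^ 'n. \<forall>i. v $ i \<in> S}"
    and "card {v :: 'a ^ 'n. \<forall>i. v $ i \<in> S} \<le> card S ^ CARD('n)"
proof -
  have eq: "{v :: 'a ^ 'n. \<forall>i. v $ i \<in> S} = vec_lambda ` (Pi\<^sub>E UNIV (\<lambda>_. S))"
  proof (intro equalityI subsetI)
    fix v :: "'a ^ 'n" assume "v \<in> {v. \<forall>i. v $ i \<in> S}"
    then show "v \<in> vec_lambda ` (Pi\<^sub>E UNIV (\<lambda>_. S))"
      by (intro image_eqI[of _ _ "vec_nth v"]) auto
  qed auto
  have fin: "finite (Pi\<^sub>E (UNIV :: 'n set) (\<lambda>_. S))"
    using assms by (intro finite_PiE) auto
  show "finite {v :: 'a ^ 'n. \<forall>i. v $ i \<in> S}"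
    unfolding eq using fin by simp
  show "card {v :: 'a ^ 'n. \<forall>i. v $ i \<in> S} \<le> card S ^ CARD('n)"
    unfolding eq using card_image_le[OF fin, of vec_lambda] by (simp add: card_PiE)
qed

text \<open>The support in the cube is covered by boxes of side \<open>4 * Q / N\<close> around the
  fractions \<open>a / q\<close>. Per coordinate there are at most \<open>Q\<close> denominators and
  \<open>4 * Q\<close> numerators, so the total measure is at most
  \<open>(16 * Q ^ 3 / N) ^ CARD('n)\<close>.\<close>

lemma norm_kernel_M_hat_le:
  fixes \<psi> :: "real ^ 'n \<Rightarrow> real"
  assumes \<psi>: "cutoff \<psi>" and Q: "Q \<ge> 1" "2 * Q \<le> N"
    and bd: "AE \<xi> in unit_cube. norm (M_hat k \<psi> l N Q \<xi>) \<le> R" and R: "R \<ge> 0"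
  shows "norm (multiplier_kernel (M_hat k \<psi> l N Q) x) \<le> R * (16 * Q ^ 3 / N) ^ CARD('n)"
proof -
  have N: "N > 0" using Q by linarith
  \<comment> \<open>Half the side of a box: since \<open>q $ i \<ge> 1\<close>, dividing the support
    condition by \<open>q $ i\<close> still gives a distance of at most \<open>\<eta>\<close> from
    \<open>a / q\<close>.\<close>
  define \<eta> where "\<eta> = 2 * Q / N"
  have \<eta>: "0 < \<eta>" "\<eta> \<le> 1" using N Q by (auto simp: \<eta>_def)
  define m where "m = nat \<lfloor>Q\<rfloor>"
  have m: "real m \<le> Q" "1 \<le> m" using Q by (auto simp: m_def le_nat_floor)
  define V where "V = {q :: nat ^ 'n. \<forall>i. q $ i \<in> {1..m}}"
  \<comment> \<open>On the cube \<open>q $ i * \<xi> $ i\<close> lies between 0 and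
    \<open>m\<close>, and \<open>\<eta> \<le> 1\<close> by \<open>2 * Q \<le> N\<close>. The
    numerators therefore reach at most one step beyond either end, which makes \<open>m + 3\<close>
    integers.\<close>
  define U where "U = {a :: int ^ 'n. \<forall>i. a $ i \<in> {-1..int m + 1}}"
  define box where "box qa = (case qa of (q, a) \<Rightarrow>
      cbox (\<chi> i. real_of_int (a $ i) / real (q $ i) - \<eta>)
        (\<chi> i. real_of_int (a $ i) / real (q $ i) + \<eta>))" for qa :: "(nat ^ 'n) \<times> (int ^ 'n)"
  have V: "finite V" "card V \<le> m ^ CARD('n)"
    unfolding V_def using finite_card_vec_Collect[where 'n = 'n, of "{1..m}"] by auto
  have U: "finite U" "card U \<le> (m + 3) ^ CARD('n)"
    unfolding U_def using finite_card_vec_Collect[where 'n = 'n, of "{-1..int m + 1}"]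
    by (auto simp: nat_add_distrib add.commute)
  have box: "measure lborel (box qa) = (2 * \<eta>) ^ CARD('n)" for qa
    using \<eta> by (cases qa) (simp add: box_def content_cbox_cart interval_ne_empty_cart)
  have "measure lborel (\<Union>qa\<in>V \<times> U. box qa) \<le> (\<Sum>qa\<in>V \<times> U. measure lborel (box qa))"
    using V U by (intro measure_UNION_le) (auto simp: box_def)
  also have "\<dots> = real (card V * card U) * (2 * \<eta>) ^ CARD('n)"
    by (simp add: box card_cartesian_product)
  also have "\<dots> \<le> real (m ^ CARD('n) * (m + 3) ^ CARD('n)) * (2 * \<eta>) ^ CARD('n)"
    using V U \<eta> by (intro mult_right_mono of_nat_mono mult_mono) auto
  also have "\<dots> = (real m * (real m + 3) * (2 * \<eta>)) ^ CARD('n)"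
    by (simp add: power_mult_distrib)
  \<comment> \<open>From \<open>m \<le> Q\<close> and \<open>1 \<le> Q\<close> follows
    \<open>m + 3 \<le> 4 * Q\<close>.\<close>
  also have "\<dots> \<le> (Q * (4 * Q) * (2 * \<eta>)) ^ CARD('n)"
    using m Q \<eta> by (intro power_mono mult_mono) auto
  also have "Q * (4 * Q) * (2 * \<eta>) = 16 * Q ^ 3 / N"
    by (simp add: \<eta>_def power3_eq_cube)
  finally have meas: "measure lborel (\<Union>qa\<in>V \<times> U. box qa) \<le> (16 * Q ^ 3 / N) ^ CARD('n)" .
  have "bounded (\<Union>qa\<in>V \<times> U. box qa)"
    using V U by (auto simp: box_def)
  have "norm (multiplier_kernel (M_hat k \<psi> l N Q) x) \<le> R * measure lborel (\<Union>qa\<in>V \<times> U. box qa)"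
  proof (rule norm_multiplier_kernel_le[OF bd R])
    have "closed (\<Union>qa\<in>V \<times> U. box qa)"
      using V U by (intro closed_UN) (auto simp: box_def)
    then show "(\<Union>qa\<in>V \<times> U. box qa) \<in> sets borel" by simp
    show "emeasure lborel (\<Union>qa\<in>V \<times> U. box qa) < \<infinity>"
      using emeasure_bounded_finite[OF \<open>bounded _\<close>] by simp
  next
    fix \<xi> :: "real ^ 'n"
    assume \<xi>: "\<xi> \<in> cbox 0 1" and "M_hat k \<psi> l N Q \<xi> \<noteq> 0"
    moreover have "Q > 0" using Q by simp
    ultimately obtain q :: "nat ^ 'n" and a :: "int ^ 'n" where q: "\<And>i. 1 \<le> q $ i" "\<And>i. real (q $ i) \<le> Q" and
      a: "\<And>i. \<bar>real (q $ i) * \<xi> $ i - real_of_int (a $ i)\<bar> \<le> \<eta>"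
      using M_hat_support[OF \<psi> N] unfolding \<eta>_def by blast
    have \<xi>01: "0 \<le> \<xi> $ i" "\<xi> $ i \<le> 1" for i using \<xi> by (auto simp: mem_box_cart)
    have qm: "q $ i \<le> m" for i using q(2)[of i] by (simp add: m_def le_nat_floor)
    have "q \<in> V" using q qm by (auto simp: V_def)
    moreover have "a \<in> U"
    proof -
      have "- 1 \<le> a $ i \<and> a $ i \<le> int m + 1" for i
      proof -
        have "0 \<le> real (q $ i) * \<xi> $ i" using \<xi>01 by simp
        moreover have "real (q $ i) * \<xi> $ i \<le> real m * 1"
          using \<xi>01 qm by (intro mult_mono) auto
        ultimately have "- 1 \<le> real_of_int (a $ i)" "real_of_int (a $ i) \<le> real m + 1"
          using a[of i] \<eta> by (auto simp: abs_le_iff)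
        then show ?thesis by linarith
      qed
      then show ?thesis by (auto simp: U_def)
    qed
    moreover have "\<xi> \<in> box (q, a)"
    proof -
      have "\<bar>\<xi> $ i - real_of_int (a $ i) / real (q $ i)\<bar> \<le> \<eta>" for i
      proof -
        have "1 \<le> real (q $ i)" using q(1)[of i] by simp
        then have "\<xi> $ i - real_of_int (a $ i) / real (q $ i) =
            (real (q $ i) * \<xi> $ i - real_of_int (a $ i)) / real (q $ i)"
          by (simp add: diff_divide_distrib)
        then have "\<bar>\<xi> $ i - real_of_int (a $ i) / real (q $ i)\<bar> =
            \<bar>real (q $ i) * \<xi> $ i - real_of_int (a $ i)\<bar> / real (q $ i)"
          by simp
        also have "\<dots> \<le> \<eta> / 1"
          using a[of i] \<open>1 \<le> real (q $ i)\<close> \<eta> by (intro frac_le) auto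
        finally show ?thesis by simp
      qed
      then show ?thesis by (auto simp: box_def mem_box_cart abs_le_iff algebra_simps)
    qed
    ultimately show "\<xi> \<in> (\<Union>qa\<in>V \<times> U. box qa)" by blast
  qed
  also have "\<dots> \<le> R * (16 * Q ^ 3 / N) ^ CARD('n)"
    using meas R by (rule mult_left_mono)
  finally show ?thesis .
qed

section \<open>Comparison of scales and proof of the estimate\<close>

text \<open>Powers of the logarithm grow more slowly than \<open>N\<close>. The first two conditions
  are the hypotheses of \<open>norm_kernel_M_hat_le\<close> for \<open>Q = ln N powr C\<close>; by
  the third, the constants and powers of \<open>Q\<close> in its bound cost at most one factor
  \<open>N\<close>.\<close>

lemma eventually_log_power_le:
  fixes C R :: real
  assumes "C > 0"
  shows "\<forall>\<^sub>F N in at_top. ln N powr C \<ge> 1 \<and> 2 * ln N powr C \<le> N \<and>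
    R * (16 * (ln N powr C) ^ 3) ^ n \<le> N"
proof -
  have log: "\<forall>\<^sub>F N in at_top. c * ln N powr D \<le> N" for c D :: real
    by real_asymp
  have "\<forall>\<^sub>F N in at_top. ln N \<ge> (1 :: real)" by real_asymp
  then show ?thesis
    using log[of 2 C] log[of "R * 16 ^ n" "C * real (3 * n)"]
  proof eventually_elim
    case (elim N)
    have "(16 * (ln N powr C) ^ 3) ^ n = 16 ^ n * (ln N powr C) ^ (3 * n)"
      by (simp add: power_mult_distrib power_mult)
    also have "(ln N powr C) ^ (3 * n) = ln N powr (C * real (3 * n))"
      using elim(1) by (simp add: powr_powr flip: powr_realpow)
    finally have "R * (16 * (ln N powr C) ^ 3) ^ n = R * 16 ^ n * ln N powr (C * real (3 * n))"
      by (simp only: mult.assoc)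
    moreover have "ln N powr C \<ge> 1"
      using elim(1) assms by (intro ge_one_powr_ge_zero) auto
    ultimately show ?case
      using elim(2,3) by (simp only: simp_thms)
  qed
qed

theorem theorem3:
  fixes k :: nat and p p' B C K :: real
    and \<psi> :: "real ^ 'n \<Rightarrow> real" and G :: "nat set"
  assumes "k \<ge> 3" and "int CARD('n) \<ge> waring_threshold k"
    and "1 < p" and "p < 2" and "1 / p + 1 / p' = 1"
    and "hua_progression TYPE('n) k G"
    and "cutoff \<psi>"
    and "B > 0" and "C > 0" and "admissible_exponent k \<psi> G K B C"
  shows "\<exists>A. \<forall>\<^sub>F l in inf at_top (principal G).
    \<forall>N. real l powr (1 / real k) \<le> N \<and> N \<le> K * real l powr (1 / real k) \<longrightarrow>
      (\<forall>f \<in> lp_space p.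
         (\<forall>x. (\<lambda>y. multiplier_kernel (M_hat k \<psi> l N (ln N powr C)) (x - y) * f y)
                 summable_on UNIV) \<and>
         multiplier_operator (M_hat k \<psi> l N (ln N powr C)) f \<in> lp_space p' \<and>
         lp_norm p' (multiplier_operator (M_hat k \<psi> l N (ln N powr C)) f)
           \<le> A * real l powr ((2 - real CARD('n)) / real k * (2 / p - 1))
               * ln N powr (C * (2 / p - 1)) * lp_norm p f)"
proof -
  define n where "n = CARD('n)"
  have n: "n \<ge> 1" unfolding n_def by (simp add: Suc_leI)
  obtain A0 where A0: "\<forall>\<^sub>F l in inf at_top (principal G).
      \<forall>N. real l powr (1 / real k) \<le> N \<and> N \<le> K * real l powr (1 / real k) \<longrightarrow>
        (AE \<xi> in lborel. \<xi> \<in> cbox 0 1 \<longrightarrow>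
           norm (fourier (\<lambda>x. of_real (sigma k l x)) \<xi> - M_hat k \<psi> l N (ln N powr C) \<xi>)
             \<le> A0 * ln (real l) powr (- B))"
    using assms(10) unfolding admissible_exponent_def by blast
  \<comment> \<open>The 1 bounds the transform of \<open>sigma\<close>, and
    \<open>\<bar>A0\<bar>\<close> bounds the error once its logarithmic factor is at most 1.\<close>
  define R where "R = 1 + \<bar>A0\<bar>"
  have R: "R > 0" by (simp add: R_def)
  obtain N0 where N0: "\<And>N. N \<ge> N0 \<Longrightarrow> ln N powr C \<ge> 1 \<and> 2 * ln N powr C \<le> N \<and>
      R * (16 * (ln N powr C) ^ 3) ^ n \<le> N"
    using eventually_log_power_le[OF \<open>C > 0\<close>, of R n] unfolding eventually_at_top_linorder by blast
  have "filterlim (\<lambda>l. real l powr (1 / real k)) at_top at_top"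
    using \<open>k \<ge> 3\<close> by real_asymp
  then have "\<forall>\<^sub>F l in at_top. real l powr (1 / real k) \<ge> N0"
    by (simp add: filterlim_at_top)
  moreover have "\<forall>\<^sub>F l in at_top. ln (real l) \<ge> 1" by real_asymp
  moreover have "\<forall>\<^sub>F l in at_top. real l \<ge> 1" by real_asymp
  ultimately have large: "\<forall>\<^sub>F l in inf at_top (principal G).
      real l powr (1 / real k) \<ge> N0 \<and> ln (real l) \<ge> 1 \<and> real l \<ge> 1"
    by (intro filter_leD[OF inf_le1]) (simp add: eventually_conj_iff)
  define \<theta> where "\<theta> = 2 / p - 1"
  \<comment> \<open>The power of 2 is split off from
    \<open>(2 * \<delta>) powr \<theta>\<close>.\<close>
  define A where "A = interpolation_const R (p' - 2) powr (1 / p') * 2 powr \<theta>"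
  show ?thesis
  proof (intro exI[of _ A], use A0 large in eventually_elim, intro allI impI ballI)
    fix l N and f :: "int ^ 'n \<Rightarrow> complex"
    assume adm: "\<forall>N. real l powr (1 / real k) \<le> N \<and> N \<le> K * real l powr (1 / real k) \<longrightarrow>
        (AE \<xi> in lborel. \<xi> \<in> cbox 0 1 \<longrightarrow>
           norm (fourier (\<lambda>x. of_real (sigma k l x)) \<xi> - M_hat k \<psi> l N (ln N powr C) \<xi>)
             \<le> A0 * ln (real l) powr (- B))"
      and l: "real l powr (1 / real k) \<ge> N0 \<and> ln (real l) \<ge> 1 \<and> real l \<ge> 1"
      and N: "real l powr (1 / real k) \<le> N \<and> N \<le> K * real l powr (1 / real k)"
      and f: "f \<in> lp_space p"
    define Q where "Q = ln N powr C"
    define L where "L = real l powr (1 / real k)"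
    \<comment> \<open>The kernel bound whose power \<open>\<theta>\<close> is exactly the claimed
      dependence on \<open>l\<close> and \<open>N\<close>.\<close>
    define \<delta> where "\<delta> = real l powr ((2 - real n) / real k) * Q"
    let ?M = "M_hat k \<psi> l N Q"
    have Q: "Q \<ge> 1" "2 * Q \<le> N" "R * (16 * Q ^ 3) ^ n \<le> N"
      using N0[of N] l N by (auto simp: Q_def)
    have L: "1 \<le> L" "L \<le> N"
      using l N by (auto simp: L_def ge_one_powr_ge_zero)
    have "\<delta> > 0" using l Q by (simp add: \<delta>_def)
    \<comment> \<open>\<open>A0\<close> may be negative, hence the absolute value; the logarithm is
      at least 1 and its exponent \<open>- B\<close> is negative.\<close>
    have A0l: "A0 * ln (real l) powr (- B) \<le> \<bar>A0\<bar> * 1"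
    proof (intro mult_mono)
      show "ln (real l) powr (- B) \<le> 1"
        using l powr_mono[of "- B" 0 "ln (real l)"] \<open>B > 0\<close> by (simp split: if_splits)
    qed auto
    have "AE \<xi> in lborel. \<xi> \<in> cbox 0 1 \<longrightarrow> norm (?M \<xi>) \<le> R"
      using adm[rule_format, OF N]
    proof (eventually_elim, intro impI)
      fix \<xi> :: "real ^ 'n"
      let ?F = "fourier (\<lambda>x. of_real (sigma k l x)) \<xi>"
      assume "\<xi> \<in> cbox 0 1 \<longrightarrow> norm (?F - M_hat k \<psi> l N (ln N powr C) \<xi>) \<le> A0 * ln (real l) powr (- B)"
        "\<xi> \<in> cbox 0 1"
      then have "norm (?F - ?M \<xi>) \<le> \<bar>A0\<bar>" using A0l by (simp add: Q_def)
      moreover have "norm (?M \<xi>) \<le> norm ?F + norm (?F - ?M \<xi>)"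
        using norm_triangle_ineq4[of ?F "?F - ?M \<xi>"] by simp
      ultimately show "norm (?M \<xi>) \<le> R"
        using norm_fourier_sigma_le[of k l \<xi>] by (simp add: R_def)
    qed
    then have bd: "AE \<xi> in unit_cube. norm (?M \<xi>) \<le> R"
      unfolding unit_cube_def by (subst AE_restrict_space_iff) auto
    \<comment> \<open>Spending one factor \<open>N\<close> on the constants leaves
      \<open>N powr (1 - n)\<close>. This exponent is nonpositive, so \<open>N\<close> may be
      lowered to \<open>L\<close>; raising the exponent to \<open>2 - n\<close> and inserting
      \<open>Q \<ge> 1\<close> then only enlarges the bound.\<close>
    have kernel: "norm (multiplier_kernel ?M x) \<le> \<delta>" for x
    proof -
      have "norm (multiplier_kernel ?M x) \<le> R * (16 * Q ^ 3 / N) ^ n"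
        unfolding n_def using \<open>cutoff \<psi>\<close> Q(1,2) bd R by (intro norm_kernel_M_hat_le) auto
      also have "\<dots> = R * (16 * Q ^ 3) ^ n / N ^ n"
        by (simp add: power_divide)
      also have "\<dots> \<le> N / N ^ n"
        using Q L by (intro divide_right_mono) auto
      also have "\<dots> = 1 / N ^ (n - 1)"
        using n L by (cases n) auto
      also have "\<dots> \<le> 1 / L ^ (n - 1)"
        using L by (intro divide_left_mono power_mono) auto
      also have "\<dots> = L powr (1 - real n)"
        using n L by (simp add: powr_diff powr_realpow power_diff)
      also have "\<dots> \<le> L powr (2 - real n) * 1"
        using L by (simp add: powr_mono)
      also have "\<dots> \<le> L powr (2 - real n) * Q"
        using Q by (intro mult_left_mono) auto
      also have "\<dots> = \<delta>"
        by (simp add: L_def \<delta>_def powr_powr)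
      finally show ?thesis .
    qed
    note interpolated = kernel_interpolation[OF \<open>1 < p\<close> \<open>p < 2\<close> \<open>1 / p + 1 / p' = 1\<close> \<open>\<delta> > 0\<close>
        kernel l2_bounded_multiplier_kernel[OF bd] f]
    have "(2 * \<delta>) powr \<theta> = 2 powr \<theta> *
        (real l powr ((2 - real n) / real k * \<theta>) * ln N powr (C * \<theta>))"
      using Q by (simp add: \<delta>_def powr_mult powr_powr) (simp add: Q_def powr_powr)
    then have const: "interpolation_const R (p' - 2) powr (1 / p') * (2 * \<delta>) powr \<theta> =
        A * real l powr ((2 - real n) / real k * \<theta>) * ln N powr (C * \<theta>)"
      by (simp add: A_def)
    show "(\<forall>x. (\<lambda>y. multiplier_kernel (M_hat k \<psi> l N (ln N powr C)) (x - y) * f y)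
                 summable_on UNIV) \<and>
         multiplier_operator (M_hat k \<psi> l N (ln N powr C)) f \<in> lp_space p' \<and>
         lp_norm p' (multiplier_operator (M_hat k \<psi> l N (ln N powr C)) f)
           \<le> A * real l powr ((2 - real CARD('n)) / real k * (2 / p - 1))
               * ln N powr (C * (2 / p - 1)) * lp_norm p f"
      using interpolated(1,2) interpolated(3)[folded \<theta>_def, unfolded const]
      unfolding multiplier_operator_def[abs_def] Q_def \<theta>_def n_def by blast
  qed
qed

end
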